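(* Let $p,q:\mathbb{R}\to\mathbb{R}$ be cyclic functions on the interval $[0,T]$, where $T$ is the period, with $p\neq q$. For $t\ge0$ let the state probabilities be $$\nu_-(t)=\frac{\nu_-(0)+\int_0^t q(s)\exp\left\{\int_0^s p(u)+q(u)\,du\right\}ds}{\exp\left\{\int_0^t p(u)+q(u)\,du\right\}},\qquad \nu_+(t)=\frac{\nu_+(0)+\int_0^t p(s)\exp\left\{\int_0^s p(u)+q(u)\,du\right\}ds}{\exp\left\{\int_0^t p(u)+q(u)\,du\right\}}.$$ Then the invariant measures are $$\overline{\nu}_-(t)=\frac{\int_0^t p(s)g(s)\,ds}{g(t)}+\frac{\int_0^T p(s)g(s)\,ds}{g(t)\,(g(T)-1)},$$ $$\overline{\nu}_+(t)=\frac{\int_0^t q(s)g(s)\,ds}{g(t)}+\frac{\int_0^T q(s)g(s)\,ds}{g(t)\,(g(T)-1)},$$ where $$g(t)=\exp\left\{\int_0^t p(u)+q(u)\,du\right\}.$$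
   Context: $Y_t\in\{-1,+1\}$ is a two-state continuous time Markov chain. The probability of a transition from $-1$ to $+1$ in a small time interval $[t,t+dt]$ is $\sim p(t)\,dt$, and that of a transition from $+1$ to $-1$ is $\sim q(t)\,dt$. The state probabilities $\nu_\pm(t)=P(Y_t=\pm1)$ satisfy $\nu_-'=-p\,\nu_-+q\,\nu_+$, $\nu_+'=p\,\nu_--q\,\nu_+$ and $\nu_-(t)+\nu_+(t)=1$ for all $t$, with initial values $\nu_\pm(0)$ at $t=0$. The invariant measure is defined by $\overline{\nu}_\pm(t):=\lim_{N\to\infty}\nu_\pm(NT+t)$, where $N$ is an integer number of periods.
   Formalization: The printed limits have p and q interchanged (p=1, q=2, T=1 gives 2/3, not 1/3, for the − state); proved with q in the − formula and p in the + formula, for nonnegative rates integrable on [0,T] with g(T)≠1, so that the formulas are defined. *)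

theory Defs
  imports "HOL-Analysis.Analysis"
begin

text \<open>Two-state chain on -1, +1: \<open>p\<close> is the rate from -1 to +1 and \<open>q\<close> the rate from +1 to -1.\<close>

definition g_exp :: "(real \<Rightarrow> real) \<Rightarrow> (real \<Rightarrow> real) \<Rightarrow> real \<Rightarrow> real" where
  "g_exp p q t = exp (integral {0..t} (\<lambda>u. p u + q u))"

text \<open>
  The state probabilities at \<open>t \<ge> 0\<close> for the initial probability \<open>a\<close> of the state concerned,
  i.e. the solutions of \<open>\<nu>\<^sub>-' = - p \<nu>\<^sub>- + q \<nu>\<^sub>+\<close> and
  \<open>\<nu>\<^sub>+' = p \<nu>\<^sub>- - q \<nu>\<^sub>+\<close> with \<open>\<nu>\<^sub>- + \<nu>\<^sub>+ = 1\<close>. It is the rate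
  into the state that enters the numerator: \<open>q\<close> for -1 and \<open>p\<close> for +1.  The limits below
  inherit this; the source prints \<open>p\<close> and \<open>q\<close> interchanged in the two invariant measures,
  which already fails for the constant rates \<open>p = 1\<close>, \<open>q = 2\<close> (where \<open>\<nu>\<^sub>-\<close> tends to \<open>2/3\<close>).
\<close>

definition nu_minus :: "(real \<Rightarrow> real) \<Rightarrow> (real \<Rightarrow> real) \<Rightarrow> real \<Rightarrow> real \<Rightarrow> real" where
  "nu_minus p q a t = (a + integral {0..t} (\<lambda>s. q s * g_exp p q s)) / g_exp p q t"

definition nu_plus :: "(real \<Rightarrow> real) \<Rightarrow> (real \<Rightarrow> real) \<Rightarrow> real \<Rightarrow> real \<Rightarrow> real" where
  "nu_plus p q a t = (a + integral {0..t} (\<lambda>s. p s * g_exp p q s)) / g_exp p q t"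

text \<open>\<open>lim\<close> is only meaningful for a convergent sequence, so a claim about the value of
  \<open>invariant_measure\<close> has to be accompanied by \<open>has_invariant_measure\<close>.\<close>

definition has_invariant_measure :: "real \<Rightarrow> (real \<Rightarrow> real) \<Rightarrow> real \<Rightarrow> bool" where
  "has_invariant_measure T \<nu> t \<longleftrightarrow> convergent (\<lambda>N::nat. \<nu> (real N * T + t))"

definition invariant_measure :: "real \<Rightarrow> (real \<Rightarrow> real) \<Rightarrow> real \<Rightarrow> real" where
  "invariant_measure T \<nu> t = lim (\<lambda>N::nat. \<nu> (real N * T + t))"

end

theory Submission
  imports Defs
begin

text \<open>
  Over one period \<open>g\<close> and the numerators' integrands \<open>p g\<close>, \<open>q g\<close> are multiplied by the
  constant \<open>c = g(T)\<close>.  Integrals of such a function over \<open>n\<close> periods form a geometric sum, so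
  after division by \<open>g(nT + t) = c\<^sup>n g(t)\<close> everything converges because \<open>c > 1\<close>; the
  initial value is damped by \<open>c\<^sup>-\<^sup>n\<close>.
\<close>

lemma multiplicative_quasi_periodic_power:
  fixes G :: "real \<Rightarrow> real"
  assumes "T \<ge> 0" and quasi: "\<And>s. s \<ge> 0 \<Longrightarrow> G (s + T) = c * G s" and "x \<ge> 0"
  shows "G (real n * T + x) = c ^ n * G x"
proof (induction n)
  case (Suc n)
  have "G (real (Suc n) * T + x) = G ((real n * T + x) + T)"
    by (simp add: algebra_simps)
  also have "\<dots> = c * G (real n * T + x)"
    using assms by (intro quasi) simp
  finally show ?case
    using Suc by simp
qed simp

context
  fixes \<phi> :: "real \<Rightarrow> real" and T c :: real
  assumes T_pos: "T > 0"
    and quasi: "\<And>s. s \<ge> 0 \<Longrightarrow> \<phi> (s + T) = c * \<phi> s"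
    and int_T: "\<phi> integrable_on {0..T}"
begin

lemma has_integral_quasi_periodic_shift:
  assumes "\<phi> integrable_on {0..x}"
  shows "(\<phi> has_integral c * integral {0..x} \<phi>) {T..T + x}"
proof -
  have "((\<lambda>s. c * \<phi> s) has_integral c * integral {0..x} \<phi>) {0..x}"
    using assms by (intro has_integral_mult_right integrable_integral)
  also have "?this \<longleftrightarrow> ((\<lambda>s. \<phi> (s + T)) has_integral c * integral {0..x} \<phi>) {0..x}"
    by (intro has_integral_cong) (simp add: quasi)
  also have "\<dots> \<longleftrightarrow> (\<phi> has_integral c * integral {0..x} \<phi>) {T..T + x}"
    using has_integral_shift_real_ivl_iff[of \<phi> _ T "T + x" T] by simp
  finally show ?thesis .
qed

lemma has_integral_quasi_periodic_Suc:
  assumes "\<phi> integrable_on {0..x}" and "x \<ge> 0"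
  shows "(\<phi> has_integral (integral {0..T} \<phi> + c * integral {0..x} \<phi>)) {0..T + x}"
  using assms T_pos
  by (intro has_integral_combine[OF _ _ integrable_integral[OF int_T]
        has_integral_quasi_periodic_shift]) auto

text \<open>Integrability on one period propagates: each further period is a shifted and scaled copy
  of the previous stretch, and the Archimedean property covers any \<open>x\<close>.\<close>

lemma integrable_quasi_periodic: "\<phi> integrable_on {0..x}"
proof -
  have *: "\<phi> integrable_on {0..real n * T}" for n
  proof (induction n)
    case (Suc n)
    from has_integral_quasi_periodic_Suc[OF this] T_pos show ?case
      by (auto simp: algebra_simps integrable_on_def)
  qed (use integrable_on_refl[of \<phi> 0] in simp)
  obtain n where "x < real n * T"
    using reals_Archimedean3[OF T_pos] by blast
  then show ?thesis
    by (intro integrable_subinterval_real[OF *[of n]]) auto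
qed

lemma integral_quasi_periodic_Suc:
  "x \<ge> 0 \<Longrightarrow> integral {0..T + x} \<phi> = integral {0..T} \<phi> + c * integral {0..x} \<phi>"
  using has_integral_quasi_periodic_Suc[OF integrable_quasi_periodic]
  by (rule integral_unique)

text \<open>Iterating \<open>integral_quasi_periodic_Suc\<close> sums
  \<open>1 + c + ... + c ^ (n - 1)\<close>; the closed form of this sum is what excludes
  \<open>c = 1\<close>.\<close>

lemma integral_quasi_periodic_geometric:
  assumes "c \<noteq> 1" and "x \<ge> 0"
  shows "integral {0..real n * T + x} \<phi>
    = integral {0..T} \<phi> * ((c ^ n - 1) / (c - 1)) + c ^ n * integral {0..x} \<phi>"
proof (induction n)
  case (Suc n)
  have "integral {0..real (Suc n) * T + x} \<phi> = integral {0..T + (real n * T + x)} \<phi>"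
    by (simp add: algebra_simps)
  also have "\<dots> = integral {0..T} \<phi> + c * integral {0..real n * T + x} \<phi>"
    using assms T_pos by (intro integral_quasi_periodic_Suc) simp
  also note Suc
  also have "integral {0..T} \<phi>
      + c * (integral {0..T} \<phi> * ((c ^ n - 1) / (c - 1)) + c ^ n * integral {0..x} \<phi>)
    = integral {0..T} \<phi> * ((c ^ Suc n - 1) / (c - 1)) + c ^ Suc n * integral {0..x} \<phi>"
    using assms by (simp add: divide_simps) (simp add: algebra_simps)
  finally show ?case .
qed simp

lemma quasi_periodic_ratio_tendsto:
  assumes G: "\<And>s. s \<ge> 0 \<Longrightarrow> G (s + T) = c * G s" and "c > 1" and "t \<ge> 0"
  shows "(\<lambda>n. (a + integral {0..real n * T + t} \<phi>) / G (real n * T + t)) \<longlonglongrightarrow>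
    integral {0..t} \<phi> / G t + integral {0..T} \<phi> / (G t * (c - 1))"
proof -
  \<comment> \<open>\<open>- A\<close> is the fixed point of the one-period recursion that sends
    \<open>J\<close> to \<open>integral {0..T} \<phi> + c * J\<close>, so adding \<open>A\<close> to
    the integral turns the recursion into multiplication by \<open>c\<close>.\<close>
  define A where "A = integral {0..T} \<phi> / (c - 1)"
  define F where "F = integral {0..t} \<phi>"
  have "(a + integral {0..real n * T + t} \<phi>) / G (real n * T + t)
      = ((a - A) * inverse c ^ n + A + F) / G t" for n
  proof -
    have "a + integral {0..real n * T + t} \<phi> = c ^ n * ((a - A) * inverse c ^ n + A + F)"
    proof -
      have "integral {0..real n * T + t} \<phi> = A * (c ^ n - 1) + c ^ n * F"
        using \<open>c > 1\<close> \<open>t \<ge> 0\<close> integral_quasi_periodic_geometric[of t n]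
        by (simp add: A_def F_def)
      moreover have "c ^ n * inverse c ^ n = 1"
        using \<open>c > 1\<close> by (simp flip: power_mult_distrib)
      \<comment> \<open>The variable \<open>d\<close> stands for \<open>inverse c ^ n\<close>, which
        leaves a polynomial identity.\<close>
      moreover have "c ^ n * ((a - A) * d + A + F) = (a - A) * (c ^ n * d) + c ^ n * A + c ^ n * F"
        for d by algebra
      ultimately show ?thesis
        by (simp add: algebra_simps)
    qed
    moreover have "G (real n * T + t) = c ^ n * G t"
      using T_pos G \<open>t \<ge> 0\<close> by (intro multiplicative_quasi_periodic_power) auto
    \<comment> \<open>Only \<open>c ^ n\<close> is cancelled, so \<open>G t\<close> may be zero
      here.\<close>
    ultimately show ?thesis
      using \<open>c > 1\<close> by simp
  qed
  moreover have "(\<lambda>n. ((a - A) * inverse c ^ n + A + F) / G t) \<longlonglongrightarrow> ((a - A) * 0 + A + F) / G t"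
    using \<open>c > 1\<close> unfolding divide_inverse
    by (intro tendsto_intros LIMSEQ_realpow_zero) (auto simp: field_simps)
  moreover have "((a - A) * 0 + A + F) / G t
      = integral {0..t} \<phi> / G t + integral {0..T} \<phi> / (G t * (c - 1))"
    by (simp add: A_def F_def add_divide_distrib mult.commute)
  ultimately show ?thesis
    by simp
qed

end

text \<open>A continuous factor can destroy mere gauge integrability; for an absolutely integrable
  \<open>f\<close> it is harmless, being bounded and measurable on the compact interval.\<close>

lemma integrable_mult_continuous:
  fixes f g :: "real \<Rightarrow> real"
  assumes "f absolutely_integrable_on {a..b}" and "continuous_on {a..b} g"
  shows "(\<lambda>x. f x * g x) integrable_on {a..b}"
proof -
  have "(\<lambda>x. g x * f x) absolutely_integrable_on {a..b}"
    using assms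
    by (intro absolutely_integrable_bounded_measurable_product_real
        continuous_imp_measurable_on_sets_lebesgue compact_imp_bounded compact_continuous_image) auto
  then show ?thesis
    by (simp add: mult.commute set_lebesgue_integral_eq_integral(1))
qed

text \<open>The exponent's integrand is periodic, the case \<open>c = 1\<close> of the above, so its
  integral is additive over periods and \<open>exp\<close> makes this multiplicative.\<close>

lemma g_exp_add_period:
  assumes "T > 0" and "\<And>u. p (u + T) = p u" and "\<And>u. q (u + T) = q u"
    and "p integrable_on {0..T}" and "q integrable_on {0..T}" and "s \<ge> 0"
  shows "g_exp p q (s + T) = g_exp p q T * g_exp p q s"
  using integral_quasi_periodic_Suc[of T "\<lambda>u. p u + q u" 1 s] assms
  by (simp add: g_exp_def integrable_add exp_add add.commute)

text \<open>Serves both states: \<open>f\<close> is the rate into the state, and the general limit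
  is applied with \<open>c = g_exp p q T\<close>.\<close>

lemma rate_ratio_tendsto:
  assumes "T > 0" and "\<And>u. p (u + T) = p u" and "\<And>u. q (u + T) = q u"
    and "p integrable_on {0..T}" and "q integrable_on {0..T}" and "g_exp p q T > 1"
    and f: "\<And>u. f (u + T) = f u" "f absolutely_integrable_on {0..T}" and "t \<ge> 0"
  shows "(\<lambda>n. (a + integral {0..real n * T + t} (\<lambda>s. f s * g_exp p q s))
      / g_exp p q (real n * T + t)) \<longlonglongrightarrow>
    integral {0..t} (\<lambda>s. f s * g_exp p q s) / g_exp p q t
    + integral {0..T} (\<lambda>s. f s * g_exp p q s) / (g_exp p q t * (g_exp p q T - 1))"
proof (rule quasi_periodic_ratio_tendsto)
  show g: "g_exp p q (s + T) = g_exp p q T * g_exp p q s" if "s \<ge> 0" for s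
    using assms that by (intro g_exp_add_period) auto
  show "f (s + T) * g_exp p q (s + T) = g_exp p q T * (f s * g_exp p q s)" if "s \<ge> 0" for s
    using that by (simp add: f g)
  \<comment> \<open>The rates may jump, but their indefinite integral is continuous.\<close>
  have "continuous_on {0..T} (g_exp p q)"
    unfolding g_exp_def using assms
    by (intro continuous_on_exp indefinite_integral_continuous_1 integrable_add)
  with f(2) show "(\<lambda>s. f s * g_exp p q s) integrable_on {0..T}"
    by (rule integrable_mult_continuous)
qed (use assms in auto)

theorem corollary3p2:
  fixes p q :: "real \<Rightarrow> real" and T a_minus a_plus t :: real
  assumes "T > 0"
    and "\<And>u. p (u + T) = p u" and "\<And>u. q (u + T) = q u"
    and "\<And>u. p u \<ge> 0" and "\<And>u. q u \<ge> 0"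
    and "p integrable_on {0..T}" and "q integrable_on {0..T}"
    and "p \<noteq> q"
    and "g_exp p q T \<noteq> 1"
    and "a_minus \<ge> 0" and "a_plus \<ge> 0" and "a_minus + a_plus = 1"
    and "t \<ge> 0"
  shows "has_invariant_measure T (nu_minus p q a_minus) t \<and>
      invariant_measure T (nu_minus p q a_minus) t =
        integral {0..t} (\<lambda>s. q s * g_exp p q s) / g_exp p q t
        + integral {0..T} (\<lambda>s. q s * g_exp p q s) / (g_exp p q t * (g_exp p q T - 1)) \<and>
      has_invariant_measure T (nu_plus p q a_plus) t \<and>
      invariant_measure T (nu_plus p q a_plus) t =
        integral {0..t} (\<lambda>s. p s * g_exp p q s) / g_exp p q t
        + integral {0..T} (\<lambda>s. p s * g_exp p q s) / (g_exp p q t * (g_exp p q T - 1))"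
proof -
  \<comment> \<open>Nonnegative rates give \<open>g_exp p q T \<ge> 1\<close>, so excluding the
    value 1 yields the growth that damps the initial value.\<close>
  have "integral {0..T} (\<lambda>u. p u + q u) \<ge> 0"
    using assms by (intro integral_nonneg integrable_add) auto
  then have g: "g_exp p q T > 1"
    using \<open>g_exp p q T \<noteq> 1\<close> by (simp add: g_exp_def less_le)
  \<comment> \<open>Nonnegativity is used again: it upgrades integrability to absolute
    integrability.\<close>
  have "p absolutely_integrable_on {0..T}" "q absolutely_integrable_on {0..T}"
    using assms by (auto intro: nonnegative_absolutely_integrable_1)
  note lims = rate_ratio_tendsto[OF assms(1-3,6,7) g assms(2) this(1) \<open>t \<ge> 0\<close>, of a_plus]
    rate_ratio_tendsto[OF assms(1-3,6,7) g assms(3) this(2) \<open>t \<ge> 0\<close>, of a_minus]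
  show ?thesis
    unfolding has_invariant_measure_def invariant_measure_def nu_minus_def nu_plus_def
    using lims[THEN limI] lims[THEN convergentI] by blast
qed

end
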